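(* For every $k\ge 1$ the array $PD_k=(P^{(k)}_{i,j})_{i,j\ge 0}$ satisfies the weighted star-of-David (sliding-cross) rule: (1) for all integers $m,l\ge 1$ and all integers $i,j,i',j'\ge 0$ with $i+j=i'+j'$, $$\frac{P^{(k)}_{i+m,\,j+l}\;P^{(k)}_{i,j}}{P^{(k)}_{i+m,\,j}\;P^{(k)}_{i,\,j+l}}=\frac{P^{(k)}_{i'+m,\,j'+l}\;P^{(k)}_{i',j'}}{P^{(k)}_{i'+m,\,j'}\;P^{(k)}_{i',\,j'+l}};$$ (2) for every integer $s\ge 1$ and all integers $i,j,i',j'\ge 0$ with $i+j=i'+j'$, $$\prod_{t=0}^{s-1}\frac{P^{(k)}_{i+t,\,j+t}}{P^{(k)}_{i+t,\,j+s-1-t}}=\prod_{t=0}^{s-1}\frac{P^{(k)}_{i'+t,\,j'+t}}{P^{(k)}_{i'+t,\,j'+s-1-t}}.$$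
   Context: The Pascal array is the infinite array $P=(P_{i,j})_{i,j\ge 0}$ with $P_{i,j}=\binom{i+j}{i}$. For $k\ge 1$ and $i,j\ge 0$, $P^{(k)}_{i,j}$ denotes the determinant of the $k\times k$ contiguous subarray of $P$ with top-left corner at $(i,j)$: $$P^{(k)}_{i,j}=\det\big(P_{i+a,\,j+b}\big)_{0\le a,b\le k-1}.$$ *)

theory Defs
  imports Complex_Main "Jordan_Normal_Form.Determinant"
begin

definition pascal :: "nat \<Rightarrow> nat \<Rightarrow> rat" where
  "pascal i j = of_nat ((i + j) choose i)"

definition pascal_minor :: "nat \<Rightarrow> nat \<Rightarrow> nat \<Rightarrow> rat" where
  "pascal_minor k i j = det (mat k k (\<lambda>(a, b). pascal (i + a) (j + b)))"

end

(* With n = i + j, a factorial factor depending only on the row and one depending only on the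
   column turn the entry binomial(n + a + b, i + a) into binomial(n + a + b, b), and the
   Vandermonde convolution is an LU factorization of the latter matrix with unit diagonals. Hence
   P^(k)_{i,j} = h(i + j) f(i) g(j) with nowhere vanishing h, f, g. In both rules the factors f and
   g cancel, and what remains depends on i + j only. *)
theory Submission imports Defs begin

text \<open>The terms with \<open>c > b\<close> are padding, so that the sum reads as an entry of a
  product of \<open>k\<close> by \<open>k\<close> matrices. The guard makes them zero: truncated
  subtraction would give \<open>b - c = 0\<close> and hence a binomial equal to 1.\<close>

lemma vandermonde_truncated:
  assumes "b < k"
  shows "(\<Sum>c = 0..<k. (a choose c) * (if c \<le> b then (m + b) choose (b - c) else 0)) = (m + a + b) choose b"
proof -
  have "(\<Sum>c = 0..<k. (a choose c) * (if c \<le> b then (m + b) choose (b - c) else 0))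
      = (\<Sum>c\<le>b. (a choose c) * ((m + b) choose (b - c)))"
    using assms by (intro sum.mono_neutral_cong_right) auto
  also have "\<dots> = (m + a + b) choose b"
    using vandermonde[of a "m + b" b] by (simp add: ac_simps)
  finally show ?thesis .
qed

text \<open>Both sides are (i + j + a + b)! / ((i + a)! (j + b)!). The gain is a lower index
  \<open>b\<close> free of \<open>i\<close> and \<open>j\<close>, as the convolution
  requires.\<close>

lemma pascal_eq_scaled_binomial:
  "pascal (i + a) (j + b) =
    fact (i + j + a) / fact (i + a) * of_nat ((i + j + a + b) choose b) * (fact b / fact (j + b))"
proof -
  have "pascal (i + a) (j + b) = fact (i + j + a + b) / (fact (i + a) * fact (j + b))"
    using binomial_fact[of "i + a" "i + a + (j + b)", where 'a = rat]
    by (simp add: pascal_def ac_simps)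
  moreover have "(of_nat ((i + j + a + b) choose b) :: rat)
      = fact (i + j + a + b) / (fact b * fact (i + j + a))"
    by (subst binomial_fact) auto
  ultimately show ?thesis
    by (simp add: field_simps)
qed

lemma pascal_minor_eq:
  "pascal_minor k i j = (\<Prod>a<k. fact (i + j + a) / fact (i + a)) * (\<Prod>b<k. fact b / fact (j + b))"
proof -
  \<comment> \<open>\<open>L\<close> absorbs the row scaling and \<open>U\<close> the column
    scaling. They are triangular because \<open>a choose c\<close> vanishes for \<open>c > a\<close>
    and the guard in \<open>U\<close> for \<open>c > b\<close>. The diagonal binomials are 1, so
    each determinant is the product of its scaling factors.\<close>
  define L :: "rat mat" where "L = mat k k (\<lambda>(a, c). fact (i + j + a) / fact (i + a) * of_nat (a choose c))"
  define U :: "rat mat" where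
    "U = mat k k (\<lambda>(c, b). of_nat (if c \<le> b then (i + j + b) choose (b - c) else 0) * (fact b / fact (j + b)))"
  have carrier: "L \<in> carrier_mat k k" "U \<in> carrier_mat k k"
    by (auto simp: L_def U_def)
  have "mat k k (\<lambda>(a, b). pascal (i + a) (j + b)) = L * U"
  proof (rule eq_matI)
    fix a b assume "a < dim_row (L * U)" "b < dim_col (L * U)"
    then have ab: "a < k" "b < k"
      by (auto simp: L_def U_def)
    have "(L * U) $$ (a, b) = (\<Sum>c = 0..<k. L $$ (a, c) * U $$ (c, b))"
      using ab carrier by (auto simp: scalar_prod_def intro!: sum.cong)
    also have "\<dots> = fact (i + j + a) / fact (i + a)
        * of_nat (\<Sum>c = 0..<k. (a choose c) * (if c \<le> b then (i + j + b) choose (b - c) else 0))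
        * (fact b / fact (j + b))"
      unfolding of_nat_sum of_nat_mult sum_distrib_left sum_distrib_right
      using ab by (intro sum.cong) (simp_all add: L_def U_def mult.assoc)
    also have "\<dots> = pascal (i + a) (j + b)"
      using ab by (simp only: vandermonde_truncated pascal_eq_scaled_binomial)
    finally show "mat k k (\<lambda>(a, b). pascal (i + a) (j + b)) $$ (a, b) = (L * U) $$ (a, b)"
      using ab by simp
  qed (auto simp: L_def U_def)
  then have "pascal_minor k i j = det L * det U"
    using det_mult[OF carrier] by (simp add: pascal_minor_def)
  moreover have "det L = (\<Prod>a<k. fact (i + j + a) / fact (i + a))"
    by (subst det_lower_triangular[OF _ carrier(1)])
      (auto simp: L_def prod_list_diag_prod atLeast0LessThan intro!: prod.cong)
  moreover have "det U = (\<Prod>b<k. fact b / fact (j + b))"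
    by (subst det_upper_triangular[OF _ carrier(2)])
      (auto simp: U_def prod_list_diag_prod atLeast0LessThan intro!: prod.cong)
  ultimately show ?thesis by simp
qed

lemma pascal_minor_factorization:
  obtains h f g :: "nat \<Rightarrow> rat"
  where "\<And>i j. pascal_minor k i j = h (i + j) * f i * g j"
    and "\<And>n. h n \<noteq> 0" "\<And>n. f n \<noteq> 0" "\<And>n. g n \<noteq> 0"
proof
  \<comment> \<open>The three products are, in order, the witnesses for \<open>h\<close>,
    \<open>f\<close> and \<open>g\<close>; the constants \<open>fact b\<close> are put into
    \<open>g\<close>.\<close>
  show "pascal_minor k i j = (\<Prod>a<k. fact (i + j + a)) * (\<Prod>a<k. 1 / fact (i + a))
      * (\<Prod>b<k. fact b / fact (j + b))" for i j
    unfolding pascal_minor_eq by (simp add: prod_dividef)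
qed auto

text \<open>The values of \<open>f\<close> at \<open>i + m\<close> and \<open>i\<close>, and of
  \<open>g\<close> at \<open>j + l\<close> and \<open>j\<close>, each occur once above and once
  below the fraction bar.\<close>

lemma cross_ratio_factored:
  fixes P :: "nat \<Rightarrow> nat \<Rightarrow> 'a :: field"
  assumes "\<And>i j. P i j = h (i + j) * f i * g j"
    and "\<And>n. f n \<noteq> 0" "\<And>n. g n \<noteq> 0"
  shows "(P (i + m) (j + l) * P i j) / (P (i + m) j * P i (j + l))
    = (h (i + j + m + l) * h (i + j)) / (h (i + j + m) * h (i + j + l))"
proof -
  have "i + m + (j + l) = i + j + m + l" "i + m + j = i + j + m" "i + (j + l) = i + j + l"
    by simp_all
  then show ?thesis
    by (simp only: assms(1)) (simp add: assms(2,3) field_simps)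
qed

text \<open>Each quotient stays within one row, so \<open>f\<close> cancels termwise, and all
  denominators lie on one antidiagonal. The values of \<open>g\<close> cancel only over the whole
  product.\<close>

lemma diagonal_ratio_factored:
  fixes P :: "nat \<Rightarrow> nat \<Rightarrow> 'a :: field"
  assumes "\<And>i j. P i j = h (i + j) * f i * g j"
    and "\<And>n. f n \<noteq> 0" "\<And>n. g n \<noteq> 0" and "s \<ge> 1"
  shows "(\<Prod>t = 0..s - 1. P (i + t) (j + t) / P (i + t) (j + s - 1 - t))
    = (\<Prod>t = 0..s - 1. h (i + j + 2 * t) / h (i + j + s - 1))"
proof -
  have "P (i + t) (j + t) / P (i + t) (j + s - 1 - t)
      = h (i + j + 2 * t) / h (i + j + s - 1) * (g (j + t) / g (j + s - 1 - t))"
    if "t \<in> {0..s - 1}" for t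
  proof -
    have "i + t + (j + t) = i + j + 2 * t" "i + t + (j + s - 1 - t) = i + j + s - 1"
      using that \<open>s \<ge> 1\<close> by auto
    then show ?thesis
      by (simp only: assms(1)) (simp add: assms(2))
  qed
  \<comment> \<open>The substitution of \<open>s - 1 - t\<close> for \<open>t\<close> runs through
    the columns from \<open>j\<close> to \<open>j + s - 1\<close> in reverse.\<close>
  moreover have "(\<Prod>t = 0..s - 1. g (j + s - 1 - t)) = (\<Prod>t = 0..s - 1. g (j + t))"
    using \<open>s \<ge> 1\<close> by (subst prod.atLeastAtMost_rev) (auto intro!: prod.cong arg_cong[of _ _ g])
  ultimately show ?thesis
    using assms(3) by (simp add: prod.distrib prod_dividef)
qed

theorem mainTheorem4:
  fixes k :: nat
  assumes "k \<ge> 1"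
  shows "(\<forall>i j. pascal_minor k i j \<noteq> 0) \<and>
    (\<forall>m l i j i' j' :: nat. m \<ge> 1 \<longrightarrow> l \<ge> 1 \<longrightarrow> i + j = i' + j' \<longrightarrow>
      (pascal_minor k (i + m) (j + l) * pascal_minor k i j) /
      (pascal_minor k (i + m) j * pascal_minor k i (j + l)) =
      (pascal_minor k (i' + m) (j' + l) * pascal_minor k i' j') /
      (pascal_minor k (i' + m) j' * pascal_minor k i' (j' + l))) \<and>
    (\<forall>s i j i' j' :: nat. s \<ge> 1 \<longrightarrow> i + j = i' + j' \<longrightarrow>
      (\<Prod>t = 0..s - 1. pascal_minor k (i + t) (j + t) / pascal_minor k (i + t) (j + s - 1 - t)) =
      (\<Prod>t = 0..s - 1. pascal_minor k (i' + t) (j' + t) / pascal_minor k (i' + t) (j' + s - 1 - t)))"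
proof -
  obtain h f g :: "nat \<Rightarrow> rat"
    where P: "\<And>i j. pascal_minor k i j = h (i + j) * f i * g j"
      and nz: "\<And>n. h n \<noteq> 0" "\<And>n. f n \<noteq> 0" "\<And>n. g n \<noteq> 0"
    using pascal_minor_factorization[of k] by blast
  show ?thesis
  proof (intro conjI allI impI)
    \<comment> \<open>This makes the quotients in both rules genuine, since division by zero yields
      0 in HOL.\<close>
    show "pascal_minor k i j \<noteq> 0" for i j
      by (simp add: P nz)
  \<comment> \<open>In the reduced forms \<open>i + j\<close> is a literal subterm, so the premise
    \<open>i + j = i' + j'\<close> rewrites one side into the other.\<close>
  qed (simp_all only: cross_ratio_factored[where P = "pascal_minor k", OF P nz(2,3)]
      diagonal_ratio_factored[where P = "pascal_minor k", OF P nz(2,3)])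
qed

end
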